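(* Let $n \geq 3$ and let $X = (\mathbb{R}^n, \|\cdot\|)$ be a real $n$-dimensional normed space with unit ball $B_X$. Then the following conditions are equivalent: (a) there exists a subspace $Y$ of $X$ such that $\dim Y = n-1$ and $\lambda(Y, X) = 2-\frac{2}{n}$; (b) there exists a linear operator $T: \mathbb{R}^n \to \mathbb{R}^n$ such that $C \subset T(B_X) \subset P$, where $C$ is the cross-polytope $\{ x \in \mathbb{R}^n: |x_1| + |x_2| + \ldots + |x_n| \leq 1 \}$ and $P$ is the parallelotope bounded by the hyperplanes $\{x \in \mathbb{R}^n: x_1 + x_2 + \ldots + x_{i-1} - x_i + x_{i+1} + \ldots + x_n = \pm 1\}$ for $i=1, 2, \ldots, n$.
   Context: All normed spaces are real. For a subspace $Y$ of a normed space $X$, a projection from $X$ onto $Y$ is a bounded linear operator $P: X \to Y$ with $P|_Y = \mathrm{Id}_Y$; the relative projection constant $\lambda(Y,X)$ is the infimum of $\|P\|$ over all projections $P$ from $X$ onto $Y$. The parallelotope $P$ in the claim is the set of $x \in \mathbb{R}^n$ with $|x_1 + \ldots + x_{i-1} - x_i + x_{i+1} + \ldots + x_n| \leq 1$ for all $i = 1, \ldots, n$. *)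

theory Defs
  imports "HOL-Analysis.Analysis"
begin

text \<open>
  The type \<open>real ^ 'n\<close> already carries the Euclidean norm through its type class.  The norm of the
  space $X$ is therefore an explicit function \<open>N\<close>, and the library notions \<open>bounded_linear\<close> and
  \<open>onorm\<close> are restated relative to \<open>N\<close>.
\<close>

definition is_norm :: "('a::real_vector \<Rightarrow> real) \<Rightarrow> bool" where
  "is_norm N \<longleftrightarrow>
     (\<forall>x. N x = 0 \<longleftrightarrow> x = 0) \<and>
     (\<forall>x y. N (x + y) \<le> N x + N y) \<and>
     (\<forall>c x. N (c *\<^sub>R x) = \<bar>c\<bar> * N x)"

definition unit_ball_wrt :: "('a::real_vector \<Rightarrow> real) \<Rightarrow> 'a set" where
  "unit_ball_wrt N = {x. N x \<le> 1}"

definition bounded_linear_wrt :: "('a::real_vector \<Rightarrow> real) \<Rightarrow> ('a \<Rightarrow> 'a) \<Rightarrow> bool" where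
  "bounded_linear_wrt N P \<longleftrightarrow> linear P \<and> (\<exists>K. \<forall>x. N (P x) \<le> N x * K)"

text \<open>As in the library's \<open>onorm\<close>, the quotient at \<open>x = 0\<close> is \<open>0 / 0 = 0\<close>.\<close>

definition onorm_wrt :: "('a::real_vector \<Rightarrow> real) \<Rightarrow> ('a \<Rightarrow> 'a) \<Rightarrow> real" where
  "onorm_wrt N P = (SUP x. N (P x) / N x)"

text \<open>
  A projection onto \<open>Y\<close> is represented as an operator on the whole space with values in \<open>Y\<close>; since
  \<open>Y\<close> has the restricted norm, this does not change the operator norm.
\<close>

definition projections_onto ::
    "('a::real_vector \<Rightarrow> real) \<Rightarrow> 'a set \<Rightarrow> ('a \<Rightarrow> 'a) set" where
  "projections_onto N Y =
     {P. bounded_linear_wrt N P \<and> (\<forall>x. P x \<in> Y) \<and> (\<forall>y\<in>Y. P y = y)}"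

text \<open>
  The infimum is taken in the reals.  For a norm \<open>N\<close> on a finite-dimensional space and a subspace
  \<open>Y\<close>, the set of projections is nonempty and the operator norms are bounded below by \<open>0\<close>.
\<close>

definition relative_projection_constant ::
    "('a::real_vector \<Rightarrow> real) \<Rightarrow> 'a set \<Rightarrow> real" where
  "relative_projection_constant N Y = (INF P \<in> projections_onto N Y. onorm_wrt N P)"

definition cross_polytope :: "(real ^ 'n) set" where
  "cross_polytope = {x. (\<Sum>i\<in>UNIV. \<bar>x $ i\<bar>) \<le> 1}"

definition sign_parallelotope :: "(real ^ 'n) set" where
  "sign_parallelotope = {x. \<forall>i. \<bar>(\<Sum>j\<in>UNIV - {i}. x $ j) - x $ i\<bar> \<le> 1}"

end

theory Submission
  imports Defs
begin

text \<open>
  Write \<open>n\<close> for the dimension.  A hyperplane is \<open>Y = {y. f \<bullet> y = 0}\<close>, and its projections are the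
  maps \<open>x - (f \<bullet> x) u\<close> with \<open>f \<bullet> u = 1\<close>.  Everything rests on a dual description of the relative
  projection constant.  The value \<open>g \<bullet> (x - (f \<bullet> x) u)\<close> is affine in \<open>u\<close>, so a separation argument
  turns the minimum over \<open>u\<close> of a maximum over pairs \<open>(x, g)\<close> from the unit ball and the dual unit
  ball into one certificate: finitely many pairs \<open>(x\<^sub>k, g\<^sub>k)\<close> with positive weights \<open>c\<^sub>k\<close> of sum
  \<open>1\<close> such that the operator \<open>A = \<Sum>\<^sub>k c\<^sub>k x\<^sub>k \<otimes> g\<^sub>k\<close> satisfies \<open>A\<^sup>* f = \<mu> f\<close> and
  \<open>tr A - \<mu> \<ge> \<lambda>(Y, X)\<close> (lemma \<open>projection_constant_dual\<close>).

  The upper bound \<open>2 - 2/n\<close> is then a Hilbert space estimate.  Consider the kernel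
  \<open>E k j = g\<^sub>k \<bullet> x\<^sub>j\<close> in the space of kernels that are square integrable for the weights \<open>c\<^sub>k c\<^sub>j\<close>.
  Its norm is at most \<open>1\<close>, since its entries lie in \<open>[-1, 1]\<close>.  Let \<open>\<Pi>\<close> be the orthogonal
  projection, of rank at most \<open>n\<close>, onto the functions \<open>k \<mapsto> h \<bullet> x\<^sub>k\<close>, and let \<open>\<psi>\<close> be the
  normalised function \<open>k \<mapsto> f \<bullet> x\<^sub>k\<close>.  The kernel \<open>Q = (2/n) \<Pi> - \<psi> \<otimes> \<psi>\<close> also has norm at most
  \<open>1\<close>, and its inner product with \<open>E\<close> is \<open>(2/n) tr A - \<mu>\<close>, so this number is at most \<open>1\<close>.
  Together with \<open>tr A \<le> 1\<close> this gives \<open>tr A - \<mu> \<le> 2 - 2/n\<close>.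

  If equality holds, then \<open>E = Q\<close>, \<open>tr A = 1\<close> and all entries of \<open>E\<close> are signs.  The spectral
  form of \<open>Q\<close> gives a formula for \<open>E\<^sup>2\<close>.  Its diagonal shows that \<open>\<psi>\<close> takes the values \<open>1\<close> and
  \<open>-1\<close> only; after a change of signs, the rest of it says that the indices fall into exactly \<open>n\<close>
  classes of weight \<open>1/n\<close>, with entry \<open>1\<close> inside a class and \<open>-1\<close> between two classes
  (\<open>sign_classes\<close>).  Representatives of the classes give \<open>n\<close> vectors in the unit ball and \<open>n\<close>
  functionals in the dual ball with the same pairings as the vertices \<open>e\<^sub>j\<close> of the cross-polytope
  and the functionals \<open>2 x\<^sub>i - \<Sum>\<^sub>j x\<^sub>j\<close>, up to sign the facet functionals of the parallelotope.
  The linear map that sends the vectors to the \<open>e\<^sub>j\<close> therefore has the property in (b).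

  Conversely, given \<open>T\<close> as in (b), let \<open>Y\<close> be the kernel of \<open>x \<mapsto> \<Sum>\<^sub>i (T x)\<^sub>i\<close>.  For any projection
  \<open>P\<close> onto \<open>Y\<close>, testing \<open>P\<close> on the \<open>n\<close> preimages of the \<open>e\<^sub>i\<close> and averaging the values of the
  facet functionals gives \<open>\<parallel>P\<parallel> \<ge> 2 - 2/n\<close> (\<open>sandwich_imp_projection_large\<close>); the general upper
  bound gives the reverse inequality for the infimum.
\<close>

section \<open>Norms on Euclidean spaces and their dual balls\<close>

lemma is_norm_zero [simp]: "is_norm N \<Longrightarrow> N 0 = 0"
  and is_norm_triangle: "is_norm N \<Longrightarrow> N (x + y) \<le> N x + N y"
  and is_norm_scale: "is_norm N \<Longrightarrow> N (r *\<^sub>R x) = \<bar>r\<bar> * N x"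
  and is_norm_eq_0: "is_norm N \<Longrightarrow> N x = 0 \<longleftrightarrow> x = 0"
  by (auto simp: is_norm_def)

lemma is_norm_minus: "is_norm N \<Longrightarrow> N (- x) = N x"
  using is_norm_scale[of N "-1" x] by simp

lemma is_norm_ge_0: "is_norm N \<Longrightarrow> 0 \<le> N x"
  using is_norm_triangle[of N x "- x"] is_norm_minus[of N x] is_norm_zero[of N] by simp

lemma is_norm_pos: "is_norm N \<Longrightarrow> x \<noteq> 0 \<Longrightarrow> 0 < N x"
  using is_norm_ge_0[of N x] is_norm_eq_0[of N x] by linarith

lemma is_norm_sum:
  assumes "is_norm N" "finite A"
  shows "N (\<Sum>i\<in>A. h i) \<le> (\<Sum>i\<in>A. N (h i))"
  using assms(2)
proof induction
  case (insert a A)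
  then show ?case using is_norm_triangle[OF assms(1), of "h a" "sum h A"] by simp
qed (simp add: assms)

lemma is_norm_convex_on: "is_norm N \<Longrightarrow> convex_on UNIV N"
proof (rule convex_onI)
  fix t :: real and x y
  assume N: "is_norm N" and "0 < t" "t < 1"
  then show "N ((1 - t) *\<^sub>R x + t *\<^sub>R y) \<le> (1 - t) * N x + t * N y"
    using is_norm_triangle[OF N, of "(1 - t) *\<^sub>R x" "t *\<^sub>R y"] by (simp add: is_norm_scale)
qed auto

lemma is_norm_continuous:
  fixes N :: "'a::euclidean_space \<Rightarrow> real"
  assumes "is_norm N"
  shows "continuous_on S N"
  using convex_on_continuous[OF open_UNIV is_norm_convex_on[OF assms]] continuous_on_subset by blast

text \<open>
  The constants are the extrema of \<open>N\<close> on the Euclidean unit sphere.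
\<close>

lemma is_norm_equivalent:
  fixes N :: "'a::euclidean_space \<Rightarrow> real"
  assumes "is_norm N"
  obtains m M where "0 < m" "\<And>x. m * norm x \<le> N x" "\<And>x. N x \<le> M * norm x"
proof -
  let ?S = "sphere (0::'a) 1"
  have ne: "?S \<noteq> {}" using vector_choose_size[of 1] by (auto simp: sphere_def dist_norm)
  obtain a where a: "a \<in> ?S" "\<And>x. x \<in> ?S \<Longrightarrow> N a \<le> N x"
    using continuous_attains_inf[OF compact_sphere ne is_norm_continuous[OF assms]] by blast
  obtain b where b: "b \<in> ?S" "\<And>x. x \<in> ?S \<Longrightarrow> N x \<le> N b"
    using continuous_attains_sup[OF compact_sphere ne is_norm_continuous[OF assms]] by blast
  have sc: "N x = norm x * N (x /\<^sub>R norm x)" "x /\<^sub>R norm x \<in> ?S" if "x \<noteq> 0" for x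
    using that by (auto simp: is_norm_scale[OF assms])
  show thesis
  proof
    show "0 < N a" using a(1) by (intro is_norm_pos assms) auto
    show "N a * norm x \<le> N x" for x
      using a(2)[OF sc(2), of x] sc(1)[of x]
      by (cases "x = 0") (auto simp: assms mult.commute mult_left_mono)
    show "N x \<le> N b * norm x" for x
      using b(2)[OF sc(2), of x] sc(1)[of x]
      by (cases "x = 0") (auto simp: assms mult.commute mult_left_mono)
  qed
qed

lemma compact_unit_ball_wrt:
  fixes N :: "'a::euclidean_space \<Rightarrow> real"
  assumes "is_norm N"
  shows "compact (unit_ball_wrt N)"
proof -
  obtain m M where m: "0 < m" "\<And>x. m * norm x \<le> N x" "\<And>x. N x \<le> M * norm x"
    using is_norm_equivalent[OF assms] by blast
  have "norm x \<le> 1 / m" if "N x \<le> 1" for x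
    using m(2)[of x] that m(1) by (simp add: field_simps)
  then have "bounded (unit_ball_wrt N)"
    unfolding bounded_iff unit_ball_wrt_def by blast
  moreover have "closed (unit_ball_wrt N)"
    unfolding unit_ball_wrt_def by (intro closed_Collect_le is_norm_continuous assms continuous_on_const)
  ultimately show ?thesis by (simp add: compact_eq_bounded_closed)
qed

text \<open>
  The inner product represents every functional by a vector, so the unit ball of the dual space is a
  set of vectors.
\<close>

definition dual_ball :: "('a::real_inner \<Rightarrow> real) \<Rightarrow> 'a set" where
  "dual_ball N = {g. \<forall>x. g \<bullet> x \<le> N x}"

lemma dual_ball_abs_le:
  assumes "is_norm N" "g \<in> dual_ball N"
  shows "\<bar>g \<bullet> x\<bar> \<le> N x"
  using assms(2) is_norm_minus[OF assms(1), of x] unfolding dual_ball_def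
  by (auto simp: abs_le_iff dest: spec[of _ "- x"])

lemma dual_ball_minus:
  assumes "is_norm N" "g \<in> dual_ball N"
  shows "- g \<in> dual_ball N"
  using dual_ball_abs_le[OF assms] by (auto simp: dual_ball_def abs_le_iff)

lemma compact_dual_ball:
  fixes N :: "'a::euclidean_space \<Rightarrow> real"
  assumes "is_norm N"
  shows "compact (dual_ball N)"
proof -
  obtain m M where m: "0 < m" "\<And>x. m * norm x \<le> N x" "\<And>x. N x \<le> M * norm x"
    using is_norm_equivalent[OF assms] by blast
  have "norm g \<le> M" if "g \<in> dual_ball N" for g
  proof (cases "g = 0")
    case True
    obtain b :: 'a where "b \<in> Basis" using nonempty_Basis by blast
    then have "m * 1 \<le> M * 1" using order_trans[OF m(2)[of b] m(3)[of b]] by simp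
    then show ?thesis using True m(1) by simp
  next
    case False
    have "norm g * norm g = g \<bullet> g" by (simp add: dot_square_norm power2_eq_square)
    also have "\<dots> \<le> M * norm g" using that m(3)[of g] unfolding dual_ball_def
      by (blast intro: order_trans)
    finally have "norm g * norm g \<le> M * norm g" .
    then show ?thesis using False by simp
  qed
  then have "bounded (dual_ball N)" unfolding bounded_iff by blast
  moreover have "dual_ball N = (\<Inter>x. {g. g \<bullet> x \<le> N x})" by (auto simp: dual_ball_def)
  then have "closed (dual_ball N)"
    by (auto intro!: closed_Collect_le continuous_intros)
  ultimately show ?thesis by (simp add: compact_eq_bounded_closed)
qed

text \<open>
  This is the Hahn--Banach theorem in finite dimension.  A vector outside the ball of radius \<open>b\<close>
  is separated from it by a hyperplane, whose normal, rescaled, is a functional in the dual ball with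
  a value above \<open>b\<close> at that vector.
\<close>

lemma dual_ball_norming:
  fixes N :: "'a::euclidean_space \<Rightarrow> real"
  assumes N: "is_norm N" and "0 < b" and le: "\<And>g. g \<in> dual_ball N \<Longrightarrow> g \<bullet> y \<le> b"
  shows "N y \<le> b"
proof (rule ccontr)
  assume y: "\<not> N y \<le> b"
  have "convex {x. N x \<le> b}"
  proof (rule convexI, unfold mem_Collect_eq)
    fix x y and u v :: real
    assume "N x \<le> b" "N y \<le> b" and uv: "0 \<le> u" "0 \<le> v" "u + v = 1"
    then have "u * N x + v * N y \<le> u * b + v * b" by (intro add_mono mult_left_mono)
    then show "N (u *\<^sub>R x + v *\<^sub>R y) \<le> b"
      using is_norm_triangle[OF N, of "u *\<^sub>R x" "v *\<^sub>R y"] uv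
      by (simp add: is_norm_scale[OF N] flip: distrib_right)
  qed
  moreover have "closed {x. N x \<le> b}"
    by (intro closed_Collect_le is_norm_continuous N continuous_on_const)
  ultimately obtain a d where a: "a \<bullet> y < d" "\<And>x. N x \<le> b \<Longrightarrow> d < a \<bullet> x"
    using separating_hyperplane_closed_point[of "{x. N x \<le> b}" y] y by auto
  have d: "d < 0" using a(2)[of 0] \<open>0 < b\<close> N by simp
  \<comment> \<open>The factor is negative, since \<open>a\<close> takes its large values on the ball, and it makes \<open>b\<close> the threshold.\<close>
  define g where "g = (b / d) *\<^sub>R a"
  have "g \<bullet> x \<le> N x" for x
  proof (cases "x = 0")
    case False
    then have p: "0 < N x" by (rule is_norm_pos[OF N])
    then have "N ((b / N x) *\<^sub>R x) \<le> b" using \<open>0 < b\<close> by (simp add: is_norm_scale[OF N])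
    then have "d < a \<bullet> ((b / N x) *\<^sub>R x)" by (rule a(2))
    then have "d * N x < b * (a \<bullet> x)" using p by (simp add: field_simps)
    then show ?thesis using d by (simp add: g_def field_simps)
  qed (simp add: N)
  then have "g \<bullet> y \<le> b" by (intro le) (simp add: dual_ball_def)
  then show False using a(1) d \<open>0 < b\<close> by (simp add: g_def field_simps)
qed

section \<open>Projections onto a hyperplane\<close>

definition hyperplane_projection :: "'a::real_inner \<Rightarrow> 'a \<Rightarrow> 'a \<Rightarrow> 'a" where
  "hyperplane_projection f u x = x - (f \<bullet> x) *\<^sub>R u"

lemma hyperplane_projection_mem:
  assumes "is_norm N" "f \<bullet> u = 1"
    and "\<And>x. N (hyperplane_projection f u x) \<le> b * N x"
  shows "hyperplane_projection f u \<in> projections_onto N {x. f \<bullet> x = 0}"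
proof -
  have "linear (hyperplane_projection f u)"
    by (rule linearI) (simp_all add: hyperplane_projection_def inner_add_right algebra_simps)
  then show ?thesis
    using assms(2,3) unfolding projections_onto_def bounded_linear_wrt_def
    by (auto simp: hyperplane_projection_def inner_diff_right mult.commute[of b])
qed

text \<open>
  Over an empty set of projections the infimum would be an arbitrary real number, so a lower bound
  for the relative projection constant needs this fact.
\<close>

lemma projections_onto_hyperplane_nonempty:
  fixes N :: "'a::euclidean_space \<Rightarrow> real"
  assumes N: "is_norm N" and "f \<noteq> 0"
  shows "projections_onto N {x. f \<bullet> x = 0} \<noteq> {}"
proof -
  obtain m M where m: "0 < m" "\<And>x. m * norm x \<le> N x" "\<And>x. N x \<le> M * norm x"
    using is_norm_equivalent[OF N] by blast
  define u where "u = f /\<^sub>R (f \<bullet> f)"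
  have fu: "f \<bullet> u = 1" using \<open>f \<noteq> 0\<close> by (simp add: u_def)
  have "N (hyperplane_projection f u x) \<le> (1 + norm f * N u / m) * N x" for x
  proof -
    have "\<bar>f \<bullet> x\<bar> \<le> norm f * norm x" by (rule Cauchy_Schwarz_ineq2)
    also have "\<dots> \<le> norm f * (N x / m)"
      using m(2)[of x] m(1) by (intro mult_left_mono) (auto simp: field_simps)
    finally have "\<bar>f \<bullet> x\<bar> * N u \<le> norm f * (N x / m) * N u"
      by (rule mult_right_mono) (rule is_norm_ge_0[OF N])
    moreover have "N (hyperplane_projection f u x) \<le> N x + \<bar>f \<bullet> x\<bar> * N u"
      using is_norm_triangle[OF N, of x "- ((f \<bullet> x) *\<^sub>R u)"]
      by (simp add: hyperplane_projection_def is_norm_minus[OF N] is_norm_scale[OF N])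
    ultimately show ?thesis by (simp add: field_simps)
  qed
  from hyperplane_projection_mem[OF N fu this] show ?thesis by blast
qed

lemma onorm_wrt_upper:
  assumes "is_norm N" "P \<in> projections_onto N Y"
  shows "N (P x) \<le> onorm_wrt N P * N x"
proof (cases "x = 0")
  case True
  then show ?thesis using assms by (auto simp: projections_onto_def bounded_linear_wrt_def linear_0)
next
  case False
  obtain K where K: "\<And>x. N (P x) \<le> N x * K"
    using assms by (auto simp: projections_onto_def bounded_linear_wrt_def)
  have "N (P x) / N x \<le> \<bar>K\<bar>" for x
  proof (cases "x = 0")
    case False
    then have "0 < N x" by (rule is_norm_pos[OF assms(1)])
    then have "N (P x) / N x \<le> K" using K[of x] by (simp add: field_simps)
    then show ?thesis by linarith
  qed (simp add: assms)
  then have "bdd_above (range (\<lambda>x. N (P x) / N x))" by (intro bdd_aboveI2)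
  then have "N (P x) / N x \<le> onorm_wrt N P"
    unfolding onorm_wrt_def by (intro cSUP_upper) auto
  then show ?thesis using is_norm_pos[OF assms(1) False] by (simp add: field_simps)
qed

lemma onorm_wrt_ge_0:
  fixes N :: "'a::euclidean_space \<Rightarrow> real"
  assumes "is_norm N" "P \<in> projections_onto N Y"
  shows "0 \<le> onorm_wrt N P"
proof -
  obtain x :: 'a where "x \<noteq> 0" using nonzero_Basis nonempty_Basis by blast
  then have "0 < N x" by (rule is_norm_pos[OF assms(1)])
  moreover have "0 \<le> onorm_wrt N P * N x"
    using onorm_wrt_upper[OF assms, of x] is_norm_ge_0[OF assms(1), of "P x"] by linarith
  ultimately show ?thesis by (simp add: zero_le_mult_iff)
qed

lemma relative_projection_constant_le:
  fixes N :: "'a::euclidean_space \<Rightarrow> real"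
  assumes N: "is_norm N" and P: "P \<in> projections_onto N Y"
    and "0 \<le> b" and le: "\<And>x. N (P x) \<le> b * N x"
  shows "relative_projection_constant N Y \<le> b"
proof -
  have "N (P x) / N x \<le> b" for x
    using le[of x] is_norm_pos[OF N, of x] \<open>0 \<le> b\<close> by (cases "x = 0") (auto simp: N field_simps)
  then have "onorm_wrt N P \<le> b" unfolding onorm_wrt_def by (intro cSUP_least) auto
  moreover have "bdd_below (onorm_wrt N ` projections_onto N Y)"
    using onorm_wrt_ge_0[OF N] by (intro bdd_belowI2)
  ultimately show ?thesis
    unfolding relative_projection_constant_def using P by (intro cINF_lower2)
qed

text \<open>
  The point \<open>(\<Sum>\<^sub>k c\<^sub>k (g\<^sub>k \<bullet> x\<^sub>k), \<Sum>\<^sub>k c\<^sub>k (f \<bullet> x\<^sub>k) g\<^sub>k)\<close> ranges over the compact convex hull of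
  the points \<open>(g \<bullet> x, (f \<bullet> x) g)\<close>.  A certificate is a common point of this hull and the closed
  convex set of all \<open>(s, \<mu> f)\<close> with \<open>s - \<mu> \<ge> \<lambda>\<close>.  If there were none, a separating functional
  \<open>(\<alpha>, w)\<close> would have \<open>\<alpha> > 0\<close>, and \<open>u = - w / \<alpha>\<close> would define a projection of norm less than
  \<open>\<lambda>\<close>.
\<close>

lemma projection_constant_dual:
  fixes N :: "'a::euclidean_space \<Rightarrow> real"
  assumes N: "is_norm N" and f: "f \<noteq> 0"
  obtains K :: "(real \<times> 'a) set" and c x g \<mu> where
    "finite K" "\<And>k. k \<in> K \<Longrightarrow> 0 < c k" "(\<Sum>k\<in>K. c k) = (1::real)"
    "\<And>k. k \<in> K \<Longrightarrow> x k \<in> unit_ball_wrt N" "\<And>k. k \<in> K \<Longrightarrow> g k \<in> dual_ball N"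
    "(\<Sum>k\<in>K. (c k * (f \<bullet> x k)) *\<^sub>R g k) = \<mu> *\<^sub>R f"
    "relative_projection_constant N {y. f \<bullet> y = 0} \<le> (\<Sum>k\<in>K. c k * (g k \<bullet> x k)) - \<mu>"
proof -
  let ?l = "relative_projection_constant N {y. f \<bullet> y = 0}"
  define F :: "'a \<times> 'a \<Rightarrow> real \<times> 'a" where "F = (\<lambda>(x, g). (g \<bullet> x, (f \<bullet> x) *\<^sub>R g))"
  define E where "E = F ` (unit_ball_wrt N \<times> dual_ball N)"
  define h :: "real \<times> real \<Rightarrow> real \<times> 'a" where "h = (\<lambda>(s, \<mu>). (s, \<mu> *\<^sub>R f))"
  define H where "H = {z :: real \<times> real. ?l \<le> fst z - snd z}"
  have E_mem: "(g \<bullet> x, (f \<bullet> x) *\<^sub>R g) \<in> E" if "N x \<le> 1" "g \<in> dual_ball N" for x g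
    using that by (force simp: E_def F_def unit_ball_wrt_def)
  have zero: "0 \<in> E" using E_mem[of 0 0] N
    by (simp add: dual_ball_def is_norm_ge_0 zero_prod_def)
  have "compact E" unfolding E_def F_def
    by (intro compact_continuous_image compact_Times compact_unit_ball_wrt compact_dual_ball N)
      (auto simp: case_prod_beta intro!: continuous_intros)
  then have cpt: "compact (convex hull E)" by (rule compact_convex_hull)
  have lin: "linear h"
    by (rule linearI) (auto simp: h_def case_prod_beta algebra_simps)
  have inj: "inj h" using f by (auto simp: h_def inj_def)
  have "closed H" unfolding H_def by (intro closed_Collect_le continuous_intros)
  then have cl: "closed (h ` H)" by (rule closed_injective_linear_image[OF _ lin inj])
  have "convex H" unfolding H_def
  proof (rule convexI, unfold mem_Collect_eq)
    fix x y :: "real \<times> real" and u v :: real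
    assume *: "?l \<le> fst x - snd x" "?l \<le> fst y - snd y" and uv: "0 \<le> u" "0 \<le> v" "u + v = 1"
    then have "u * ?l + v * ?l \<le> u * (fst x - snd x) + v * (fst y - snd y)"
      by (intro add_mono mult_left_mono)
    moreover have "u * ?l + v * ?l = ?l" using uv(3) by (simp flip: distrib_right)
    ultimately show "?l \<le> fst (u *\<^sub>R x + v *\<^sub>R y) - snd (u *\<^sub>R x + v *\<^sub>R y)"
      by (simp add: algebra_simps)
  qed
  then have cv: "convex (h ` H)" by (rule convex_linear_image[OF lin])
  have "(convex hull E) \<inter> h ` H \<noteq> {}"
  proof
    assume disj: "(convex hull E) \<inter> h ` H = {}"
    then obtain a b where ab: "\<And>z. z \<in> convex hull E \<Longrightarrow> a \<bullet> z < b" "\<And>z. z \<in> h ` H \<Longrightarrow> b < a \<bullet> z"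
      using separating_hyperplane_compact_closed[OF convex_convex_hull cpt _ cv cl] zero
      by (metis empty_iff hull_inc)
    obtain \<alpha> w where a: "a = (\<alpha>, w)" by (cases a)
    have E: "\<alpha> * (g \<bullet> x) + (f \<bullet> x) * (w \<bullet> g) < b" if "N x \<le> 1" "g \<in> dual_ball N" for x g
      using ab(1)[OF hull_inc[OF E_mem[OF that]]] by (simp add: a)
    have b: "0 < b" using ab(1)[OF hull_inc[OF zero]] by simp
    have L: "b < \<alpha> * (?l + \<mu> + r) + \<mu> * (w \<bullet> f)" if "0 \<le> r" for \<mu> r
    proof -
      have "h (?l + \<mu> + r, \<mu>) \<in> h ` H" using that by (intro imageI) (simp add: H_def)
      from ab(2)[OF this] show ?thesis by (simp add: a h_def)
    qed
    \<comment> \<open>The separating functional is bounded below on the lines in which \<open>\<mu>\<close> varies and \<open>s - \<mu>\<close> is fixed.\<close>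
    have \<alpha>wf: "\<alpha> + w \<bullet> f = 0"
    proof (rule ccontr)
      assume "\<alpha> + w \<bullet> f \<noteq> 0"
      moreover have "b < \<alpha> * ?l + \<mu> * (\<alpha> + w \<bullet> f)" for \<mu>
        using L[of 0 \<mu>] by (simp add: algebra_simps)
      from this[of "- (\<alpha> * ?l) / (\<alpha> + w \<bullet> f)"]
      have "b < \<alpha> * ?l - \<alpha> * ?l / (\<alpha> + w \<bullet> f) * (\<alpha> + w \<bullet> f)" by simp
      ultimately show False using b by simp
    qed
    have L0: "b < \<alpha> * ?l" using L[of 0 0] by simp
    have \<alpha>: "0 < \<alpha>"
    proof (rule ccontr)
      assume "\<not> 0 < \<alpha>"
      then have "\<alpha> < 0" using L0 b by (cases "\<alpha> = 0") auto
      moreover have "0 \<le> ?l + \<bar>?l\<bar>" by linarith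
      ultimately have "\<alpha> * (?l + \<bar>?l\<bar>) \<le> 0" by (simp add: mult_nonpos_nonneg)
      then show False using L[of "\<bar>?l\<bar>" 0] b by simp
    qed
    define u where "u = - (w /\<^sub>R \<alpha>)"
    have fu: "f \<bullet> u = 1" using \<alpha>wf \<alpha> by (simp add: u_def inner_commute field_simps)
    have bnd: "N (hyperplane_projection f u x) \<le> (b / \<alpha>) * N x" for x
    proof (cases "x = 0")
      case False
      then have p: "0 < N x" by (rule is_norm_pos[OF N])
      have "N (hyperplane_projection f u (x /\<^sub>R N x)) \<le> b / \<alpha>"
      proof (rule dual_ball_norming[OF N])
        fix g assume g: "g \<in> dual_ball N"
        have "N (x /\<^sub>R N x) \<le> 1" using p by (simp add: is_norm_scale[OF N])
        from E[OF this g]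
        have "\<alpha> * (g \<bullet> (x /\<^sub>R N x)) + (f \<bullet> (x /\<^sub>R N x)) * (w \<bullet> g) < b" .
        moreover have "\<alpha> * (g \<bullet> hyperplane_projection f u z) = \<alpha> * (g \<bullet> z) + (f \<bullet> z) * (w \<bullet> g)" for z
          using \<alpha> by (simp add: hyperplane_projection_def u_def inner_add_right inner_commute field_simps)
        ultimately have "\<alpha> * (g \<bullet> hyperplane_projection f u (x /\<^sub>R N x)) < b" by metis
        then show "g \<bullet> hyperplane_projection f u (x /\<^sub>R N x) \<le> b / \<alpha>"
          using \<alpha> by (simp add: field_simps)
      qed (use b \<alpha> in simp)
      moreover have "hyperplane_projection f u (x /\<^sub>R N x) = hyperplane_projection f u x /\<^sub>R N x"
        by (simp add: hyperplane_projection_def algebra_simps)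
      ultimately show ?thesis using p by (simp add: is_norm_scale[OF N] field_simps)
    qed (simp add: N hyperplane_projection_def)
    have "?l \<le> b / \<alpha>"
      using b \<alpha> by (intro relative_projection_constant_le[OF N hyperplane_projection_mem[OF N fu bnd]] bnd) auto
    then show False using L0 \<alpha> by (simp add: field_simps)
  qed
  then obtain s \<mu> where sm: "?l \<le> s - \<mu>" and hull: "(s, \<mu> *\<^sub>R f) \<in> convex hull E"
    by (auto simp: h_def H_def)
  obtain S c where S: "finite S" "S \<subseteq> E" "\<forall>z\<in>S. 0 \<le> c z" "sum c S = 1"
    and eq: "(\<Sum>z\<in>S. c z *\<^sub>R z) = (s, \<mu> *\<^sub>R f)"
    using hull unfolding convex_hull_explicit by blast
  define p where "p z = (SOME p. p \<in> unit_ball_wrt N \<times> dual_ball N \<and> F p = z)" for z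
  have p: "p z \<in> unit_ball_wrt N \<times> dual_ball N" "F (p z) = z" if "z \<in> S" for z
  proof -
    have "\<exists>p. p \<in> unit_ball_wrt N \<times> dual_ball N \<and> F p = z" using S(2) that unfolding E_def by blast
    from someI_ex[OF this] show "p z \<in> unit_ball_wrt N \<times> dual_ball N" "F (p z) = z"
      unfolding p_def by blast+
  qed
  define x where "x = fst \<circ> p"
  define g where "g = snd \<circ> p"
  have zF: "z = (g z \<bullet> x z, (f \<bullet> x z) *\<^sub>R g z)" if "z \<in> S" for z
    using p(2)[OF that] by (auto simp: F_def x_def g_def case_prod_beta)
  define K where "K = {z\<in>S. c z \<noteq> 0}"
  have KS: "K \<subseteq> S" and c0: "\<And>z. z \<in> S - K \<Longrightarrow> c z = 0" by (auto simp: K_def)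
  show thesis
  proof
    show "finite K" using S(1) KS finite_subset by blast
    show "0 < c k" if "k \<in> K" for k using that S(3) by (auto simp: K_def less_le)
    show "sum c K = 1" using S(4) sum.mono_neutral_left[OF S(1) KS, of c] c0 by auto
    show "x k \<in> unit_ball_wrt N" "g k \<in> dual_ball N" if "k \<in> K" for k
      using p(1)[of k] that KS by (auto simp: x_def g_def mem_Times_iff)
    have eq': "(\<Sum>z\<in>K. c z *\<^sub>R (g z \<bullet> x z, (f \<bullet> x z) *\<^sub>R g z)) = (s, \<mu> *\<^sub>R f)"
    proof -
      have "(\<Sum>z\<in>K. c z *\<^sub>R (g z \<bullet> x z, (f \<bullet> x z) *\<^sub>R g z)) = (\<Sum>z\<in>K. c z *\<^sub>R z)"
        using zF KS by (intro sum.cong refl) (metis subsetD)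
      also have "\<dots> = (\<Sum>z\<in>S. c z *\<^sub>R z)"
        using c0 by (intro sum.mono_neutral_left S(1) KS) auto
      finally show ?thesis using eq by simp
    qed
    show "(\<Sum>k\<in>K. (c k * (f \<bullet> x k)) *\<^sub>R g k) = \<mu> *\<^sub>R f"
      using arg_cong[OF eq', of snd] by (simp add: snd_sum)
    show "?l \<le> (\<Sum>k\<in>K. c k * (g k \<bullet> x k)) - \<mu>"
      using arg_cong[OF eq', of fst] sm by (simp add: fst_sum)
  qed
qed

section \<open>Orthogonal projections in weighted sequence spaces\<close>

text \<open>
  \<open>p\<close> is the kernel of the orthogonal projection of the weighted space \<open>\<ell>\<^sup>2(K, c)\<close> onto the span of
  the functions \<open>v\<^sub>i\<close>; its trace is the dimension of that span.  The induction is the Gram--Schmidt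
  process: a new function contributes the rank-one kernel of its component orthogonal to the earlier
  ones, or nothing if that component vanishes.
\<close>

lemma reproducing_kernel:
  fixes v :: "'i \<Rightarrow> 'k \<Rightarrow> real"
  assumes "finite I" and K: "finite K" and c: "\<And>k. k \<in> K \<Longrightarrow> 0 < c k"
  shows "\<exists>p. (\<forall>k j. p k j = p j k) \<and> (\<forall>k j. (\<Sum>l\<in>K. c l * p k l * p l j) = p k j) \<and>
    (\<forall>i\<in>I. \<forall>k\<in>K. (\<Sum>j\<in>K. c j * p k j * v i j) = v i k) \<and>
    (\<Sum>k\<in>K. c k * p k k) \<le> real (card I)"
  using assms(1)
proof induction
  case empty
  show ?case by (intro exI[of _ "\<lambda>_ _. 0"]) auto
next
  case (insert a I)
  then obtain p where sym: "\<And>k j. p k j = p j k"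
    and idem: "\<And>k j. (\<Sum>l\<in>K. c l * p k l * p l j) = p k j"
    and rep: "\<And>i k. i \<in> I \<Longrightarrow> k \<in> K \<Longrightarrow> (\<Sum>j\<in>K. c j * p k j * v i j) = v i k"
    and tr: "(\<Sum>k\<in>K. c k * p k k) \<le> real (card I)" by blast
  \<comment> \<open>The component of the new function orthogonal to the range of \<open>p\<close>, and its squared norm.\<close>
  define w where "w k = v a k - (\<Sum>j\<in>K. c j * p k j * v a j)" for k
  define s where "s = (\<Sum>k\<in>K. c k * w k * w k)"
  have pw: "(\<Sum>l\<in>K. c l * p k l * w l) = 0" for k
  proof -
    have "(\<Sum>l\<in>K. c l * p k l * (\<Sum>j\<in>K. c j * p l j * v a j))
        = (\<Sum>j\<in>K. c j * v a j * (\<Sum>l\<in>K. c l * p k l * p l j))"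
      unfolding sum_distrib_left by (subst sum.swap) (simp add: mult_ac)
    also have "\<dots> = (\<Sum>j\<in>K. c j * p k j * v a j)" unfolding idem by (simp add: mult_ac)
    finally show ?thesis by (simp add: w_def algebra_simps sum_subtractf)
  qed
  have wv: "(\<Sum>k\<in>K. c k * w k * v i k) = 0" if "i \<in> I" for i
  proof -
    have "(\<Sum>k\<in>K. c k * w k * v i k) = (\<Sum>k\<in>K. c k * w k * (\<Sum>j\<in>K. c j * p k j * v i j))"
      using rep[OF that] by simp
    also have "\<dots> = (\<Sum>j\<in>K. c j * v i j * (\<Sum>k\<in>K. c k * p j k * w k))"
      unfolding sum_distrib_left by (subst sum.swap) (simp add: mult_ac sym)
    finally show ?thesis by (simp add: pw)
  qed
  have wva: "(\<Sum>k\<in>K. c k * w k * v a k) = s"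
  proof -
    have "(\<Sum>k\<in>K. c k * w k * (\<Sum>j\<in>K. c j * p k j * v a j))
        = (\<Sum>j\<in>K. c j * v a j * (\<Sum>k\<in>K. c k * p j k * w k))"
      unfolding sum_distrib_left by (subst sum.swap) (simp add: mult_ac sym)
    then have "(\<Sum>k\<in>K. c k * w k * (\<Sum>j\<in>K. c j * p k j * v a j)) = 0" by (simp add: pw)
    moreover have "s = (\<Sum>k\<in>K. c k * w k * v a k) - (\<Sum>k\<in>K. c k * w k * (\<Sum>j\<in>K. c j * p k j * v a j))"
      unfolding s_def sum_subtractf[symmetric]
      by (intro sum.cong refl) (subst (2) w_def, simp add: algebra_simps)
    ultimately show ?thesis by simp
  qed
  show ?case
  proof (cases "s = 0")
    case True
    have "\<forall>k\<in>K. c k * w k * w k = 0"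
      using True c unfolding s_def
      by (subst (asm) sum_nonneg_eq_0_iff) (auto simp: K mult.assoc less_imp_le)
    then have "w k = 0" if "k \<in> K" for k using that c[of k] by auto
    then have "(\<Sum>j\<in>K. c j * p k j * v a j) = v a k" if "k \<in> K" for k
      using that unfolding w_def by force
    then show ?thesis using sym idem rep tr insert(1,2) by (intro exI[of _ p]) auto
  next
    case False
    have ws: "(\<Sum>l\<in>K. c l * w l * w l) = s" by (simp add: s_def)
    define p' where "p' k j = p k j + w k * w j / s" for k j
    have "p' k j = p' j k" for k j by (simp add: p'_def sym mult.commute)
    moreover have "(\<Sum>l\<in>K. c l * p' k l * p' l j) = p' k j" for k j
    proof -
      have "(\<Sum>l\<in>K. c l * p' k l * p' l j) = (\<Sum>l\<in>K. c l * p k l * p l j)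
         + w j / s * (\<Sum>l\<in>K. c l * p k l * w l) + w k / s * (\<Sum>l\<in>K. c l * p j l * w l)
         + w k * w j / s / s * (\<Sum>l\<in>K. c l * w l * w l)"
        unfolding sum_distrib_left sum.distrib[symmetric]
        by (intro sum.cong refl) (simp add: p'_def sym[of _ j] algebra_simps)
      then show ?thesis using False by (simp add: idem pw ws p'_def)
    qed
    moreover have "(\<Sum>j\<in>K. c j * p' k j * v i j) = v i k" if "i \<in> insert a I" "k \<in> K" for i k
    proof -
      have "(\<Sum>j\<in>K. c j * p' k j * v i j)
          = (\<Sum>j\<in>K. c j * p k j * v i j) + w k / s * (\<Sum>j\<in>K. c j * w j * v i j)"
        unfolding sum_distrib_left sum.distrib[symmetric]
        by (intro sum.cong refl) (simp add: p'_def algebra_simps)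
      then show ?thesis using False that wv rep wva by (cases "i = a") (auto simp: w_def)
    qed
    moreover have "(\<Sum>k\<in>K. c k * p' k k) \<le> real (card (insert a I))"
    proof -
      have "(\<Sum>k\<in>K. c k * p' k k) = (\<Sum>k\<in>K. c k * p k k) + (\<Sum>l\<in>K. c l * w l * w l) / s"
        unfolding sum_divide_distrib sum.distrib[symmetric]
        by (intro sum.cong refl) (simp add: p'_def algebra_simps)
      then show ?thesis using tr False insert(1,2) by (simp add: ws)
    qed
    ultimately show ?thesis by blast
  qed
qed

section \<open>Sign matrices with two-valued squares\<close>

text \<open>
  If \<open>S k i = 1\<close>, then the condition on the square of \<open>S\<close> says that the weighted mean of
  \<open>S k j * S j i\<close> over \<open>j\<close> is \<open>1\<close>, so the rows \<open>k\<close> and \<open>i\<close> agree.  Hence the relation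
  \<open>S k i = 1\<close> is an equivalence.  By the row sums every class has weight \<open>1/n\<close>, so there are
  exactly \<open>n\<close> of them.
\<close>

lemma sign_classes:
  fixes S :: "'k \<Rightarrow> 'k \<Rightarrow> real"
  assumes K: "finite K" and c: "\<And>k. k \<in> K \<Longrightarrow> 0 < c k" and sumc: "(\<Sum>k\<in>K. c k) = (1::real)"
    and n: "0 < n"
    and pm: "\<And>k j. k \<in> K \<Longrightarrow> j \<in> K \<Longrightarrow> S k j = 1 \<or> S k j = -1"
    and diag: "\<And>k. k \<in> K \<Longrightarrow> S k k = 1"
    and sym: "\<And>k j. k \<in> K \<Longrightarrow> j \<in> K \<Longrightarrow> S k j = S j k"
    and sq: "\<And>k i. k \<in> K \<Longrightarrow> i \<in> K \<Longrightarrow>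
      (\<Sum>j\<in>K. c j * S k j * S j i) = 2 / real n * S k i + (1 - 2 / real n)"
    and row: "\<And>k. k \<in> K \<Longrightarrow> (\<Sum>j\<in>K. c j * S k j) = 2 / real n - 1"
  shows "\<exists>R\<subseteq>K. card R = n \<and> (\<forall>k\<in>R. \<forall>j\<in>R. k \<noteq> j \<longrightarrow> S k j = -1)"
proof -
  have same: "S k j = S i j" if "k \<in> K" "i \<in> K" "j \<in> K" "S k i = 1" for k i j
  proof -
    have "(\<Sum>j\<in>K. c j * (1 - S k j * S j i)) = 0"
      using sq[OF that(1,2)] sumc that(4) by (simp add: algebra_simps sum_subtractf)
    moreover have "0 \<le> c j * (1 - S k j * S j i)" if "j \<in> K" for j
      using pm[OF \<open>k \<in> K\<close> that] pm[OF that \<open>i \<in> K\<close>] c[OF that] by auto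
    ultimately have "c j * (1 - S k j * S j i) = 0"
      using sum_nonneg_eq_0_iff[OF K, of "\<lambda>j. c j * (1 - S k j * S j i)"] that(3) by auto
    then show ?thesis
      using c[OF that(3)] pm[OF that(1,3)] pm[OF that(2,3)] sym[OF that(2,3)] by auto
  qed
  define cl where "cl k = {j\<in>K. S k j = 1}" for k
  have weight: "(\<Sum>j\<in>cl k. c j) = 1 / real n" if "k \<in> K" for k
  proof -
    have "(\<Sum>j\<in>K. c j * S k j) = (\<Sum>j\<in>K. 2 * (if S k j = 1 then c j else 0) - c j)"
      using pm[OF that] by (intro sum.cong refl) force
    also have "\<dots> = 2 * (\<Sum>j\<in>cl k. c j) - 1"
      by (simp add: sum_subtractf sumc cl_def sum.inter_filter[OF K] flip: sum_distrib_left)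
    finally show ?thesis using row[OF that] by simp
  qed
  \<comment> \<open>A maximal set of pairwise inequivalent indices meets every class.\<close>
  let ?F = "{R. R \<subseteq> K \<and> (\<forall>k\<in>R. \<forall>j\<in>R. k \<noteq> j \<longrightarrow> S k j = -1)}"
  have "finite ?F" by (rule finite_subset[of _ "Pow K"]) (auto simp: K)
  moreover have "{} \<in> ?F" by simp
  ultimately have "\<exists>R\<in>?F. \<forall>R'\<in>?F. R \<subseteq> R' \<longrightarrow> R = R'"
    by (intro finite_has_maximal) (blast, rule notI, simp only: empty_iff)
  then obtain R where R: "R \<in> ?F" and max: "\<And>R'. R' \<in> ?F \<Longrightarrow> R \<subseteq> R' \<Longrightarrow> R = R'"
    by meson
  have RK: "R \<subseteq> K" and R_neg: "\<And>k j. k \<in> R \<Longrightarrow> j \<in> R \<Longrightarrow> k \<noteq> j \<Longrightarrow> S k j = -1"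
    using R by blast+
  have finR: "finite R" using RK K by (rule finite_subset)
  have cover: "K = (\<Union>k\<in>R. cl k)"
  proof (intro equalityI subsetI)
    fix j assume j: "j \<in> K"
    show "j \<in> (\<Union>k\<in>R. cl k)"
    proof (rule ccontr)
      assume no: "j \<notin> (\<Union>k\<in>R. cl k)"
      then have neg: "S k j = -1" if "k \<in> R" for k using pm[of k j] j that RK by (auto simp: cl_def)
      moreover have "S j k = -1" if "k \<in> R" for k
        using neg[OF that] sym[OF j, of k] that RK by auto
      ultimately have "insert j R \<in> ?F" using R_neg j RK by auto
      then have "R = insert j R" by (rule max) blast
      then have "j \<in> R" by blast
      then show False using no diag[OF j] j by (auto simp: cl_def)
    qed
  qed (auto simp: cl_def)
  have disj: "cl k \<inter> cl j = {}" if "k \<in> R" "j \<in> R" "k \<noteq> j" for k j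
  proof (rule ccontr)
    assume "cl k \<inter> cl j \<noteq> {}"
    then obtain l where l: "l \<in> K" "S k l = 1" "S j l = 1" by (auto simp: cl_def)
    have "S k j = S l j" by (rule same) (use that l RK in auto)
    also have "\<dots> = 1" using l sym[of l j] that RK by auto
    finally show False using R_neg[OF that] by simp
  qed
  have "1 = (\<Sum>k\<in>R. \<Sum>j\<in>cl k. c j)"
  proof -
    have "sum c (\<Union>k\<in>R. cl k) = (\<Sum>k\<in>R. \<Sum>j\<in>cl k. c j)"
      using disj finR by (intro sum.UNION_disjoint) (auto simp: K cl_def)
    then show ?thesis using sumc cover by simp
  qed
  also have "\<dots> = real (card R) / real n" using weight RK by (simp add: subset_iff)
  finally have "card R = n" using n by simp
  then show ?thesis using RK R_neg by blast
qed

section \<open>The trace estimate for a dual certificate\<close>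

text \<open>
  The dual certificate, separated from the norm that it comes from: of the unit balls only the
  bound on the pairings remains.  The last assumption is the equation \<open>A\<^sup>* f = \<mu> f\<close> for
  \<open>A = \<Sum>\<^sub>k c\<^sub>k x\<^sub>k \<otimes> g\<^sub>k\<close>, that is, \<open>A\<close> preserves the hyperplane orthogonal to \<open>f\<close> and acts as
  \<open>\<mu>\<close> on the quotient.
\<close>

locale weighted_pairs =
  fixes K :: "'k set" and c :: "'k \<Rightarrow> real" and x g :: "'k \<Rightarrow> 'a::euclidean_space"
    and f :: 'a and \<mu> :: real
  assumes finite_K: "finite K"
    and c_pos: "\<And>k. k \<in> K \<Longrightarrow> 0 < c k"
    and sum_c: "(\<Sum>k\<in>K. c k) = 1"
    and entry_le: "\<And>k j. k \<in> K \<Longrightarrow> j \<in> K \<Longrightarrow> \<bar>g k \<bullet> x j\<bar> \<le> 1"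
    and eigen: "(\<Sum>k\<in>K. (c k * (f \<bullet> x k)) *\<^sub>R g k) = \<mu> *\<^sub>R f"
begin

definition tr :: real where
  "tr = (\<Sum>k\<in>K. c k * (g k \<bullet> x k))"

definition mass :: real where
  "mass = (\<Sum>k\<in>K. c k * (f \<bullet> x k)\<^sup>2)"

definition \<psi> :: "'k \<Rightarrow> real" where
  "\<psi> k = (f \<bullet> x k) / sqrt mass"

lemma tr_le_1: "tr \<le> 1"
proof -
  have "tr \<le> (\<Sum>k\<in>K. c k * 1)"
    unfolding tr_def using entry_le c_pos by (intro sum_mono mult_left_mono) (auto simp: abs_le_iff less_imp_le)
  then show ?thesis by (simp add: sum_c)
qed

lemma mass_0_imp:
  assumes "mass = 0" "f \<noteq> 0"
  shows "\<mu> = 0"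
proof -
  have "\<forall>k\<in>K. c k * (f \<bullet> x k)\<^sup>2 = 0"
    using assms(1) c_pos unfolding mass_def
    by (subst (asm) sum_nonneg_eq_0_iff) (auto simp: finite_K less_imp_le)
  then have "\<forall>k\<in>K. f \<bullet> x k = 0" using c_pos by force
  then have "\<mu> *\<^sub>R f = 0" unfolding eigen[symmetric] by (intro sum.neutral) simp
  then show ?thesis using assms(2) by simp
qed

lemma mass_ge_0: "0 \<le> mass"
  unfolding mass_def using c_pos by (intro sum_nonneg) (auto simp: less_imp_le)

lemma \<psi>_unit:
  assumes "mass \<noteq> 0"
  shows "(\<Sum>k\<in>K. c k * (\<psi> k)\<^sup>2) = 1"
proof -
  have "(\<Sum>k\<in>K. c k * (\<psi> k)\<^sup>2) = mass / mass"
    using mass_ge_0 by (simp add: \<psi>_def power_divide flip: sum_divide_distrib mass_def)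
  then show ?thesis using assms by simp
qed

text \<open>
  In the weighted space, \<open>\<psi>\<close> is a left eigenvector of the kernel \<open>g\<^sub>k \<bullet> x\<^sub>j\<close>.
\<close>

lemma \<psi>_eigen: "(\<Sum>k\<in>K. c k * \<psi> k * (g k \<bullet> x j)) = \<mu> * \<psi> j"
proof -
  have "(\<Sum>k\<in>K. c k * (f \<bullet> x k) * (g k \<bullet> x j)) = \<mu> * (f \<bullet> x j)"
    using arg_cong[OF eigen, of "\<lambda>v. v \<bullet> x j"] by (simp add: inner_sum_left)
  then show ?thesis by (simp add: \<psi>_def flip: sum_divide_distrib)
qed

lemma kernel:
  obtains p where "\<And>k j. p k j = p j k" "\<And>k j. (\<Sum>l\<in>K. c l * p k l * p l j) = p k j"
    "\<And>k h. k \<in> K \<Longrightarrow> (\<Sum>j\<in>K. c j * p k j * (h \<bullet> x j)) = h \<bullet> x k"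
    "(\<Sum>k\<in>K. c k * p k k) \<le> real DIM('a)"
proof -
  have "\<exists>p. (\<forall>k j. p k j = p j k) \<and> (\<forall>k j. (\<Sum>l\<in>K. c l * p k l * p l j) = p k j) \<and>
    (\<forall>b\<in>Basis. \<forall>k\<in>K. (\<Sum>j\<in>K. c j * p k j * (x j \<bullet> b)) = x k \<bullet> b) \<and>
    (\<Sum>k\<in>K. c k * p k k) \<le> real DIM('a)"
    using c_pos by (rule reproducing_kernel[OF finite_Basis finite_K])
  then obtain p where p: "\<forall>k j. p k j = p j k" "\<forall>k j. (\<Sum>l\<in>K. c l * p k l * p l j) = p k j"
    and rep: "\<forall>b\<in>Basis. \<forall>k\<in>K. (\<Sum>j\<in>K. c j * p k j * (x j \<bullet> b)) = x k \<bullet> b"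
    and trp: "(\<Sum>k\<in>K. c k * p k k) \<le> real DIM('a)"
    by (elim exE conjE)
  have "(\<Sum>j\<in>K. c j * p k j * (h \<bullet> x j)) = h \<bullet> x k" if "k \<in> K" for k h
  proof -
    have "(\<Sum>j\<in>K. (c j * p k j) *\<^sub>R x j) = x k"
    proof (rule euclidean_eqI)
      fix b :: 'a assume b: "b \<in> Basis"
      have "(\<Sum>j\<in>K. (c j * p k j) *\<^sub>R x j) \<bullet> b = (\<Sum>j\<in>K. c j * p k j * (x j \<bullet> b))"
        by (simp only: inner_sum_left inner_scaleR_left)
      also have "\<dots> = x k \<bullet> b" using bspec[OF bspec[OF rep b] that] .
      finally show "(\<Sum>j\<in>K. (c j * p k j) *\<^sub>R x j) \<bullet> b = x k \<bullet> b" .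
    qed
    then show ?thesis
      using inner_sum_right[of h "\<lambda>j. (c j * p k j) *\<^sub>R x j" K]
      by (simp only: inner_scaleR_right)
  qed
  from that[OF p(1)[THEN spec, THEN spec] p(2)[THEN spec, THEN spec] this trp] show thesis .
qed

text \<open>
  The double sum is the squared distance between \<open>E k j = g\<^sub>k \<bullet> x\<^sub>j\<close> and
  \<open>Q = (2/n) \<Pi> - \<psi> \<otimes> \<psi>\<close>, with \<open>p\<close> the kernel of \<open>\<Pi>\<close>.  The bound is
  \<open>\<parallel>E - Q\<parallel>\<^sup>2 = \<parallel>E\<parallel>\<^sup>2 - 2 \<langle>E, Q\<rangle> + \<parallel>Q\<parallel>\<^sup>2\<close>, where \<open>\<langle>E, \<Pi>\<rangle> = tr\<close> because \<open>\<Pi>\<close>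
  reproduces the \<open>x\<^sub>j\<close>, where \<open>\<langle>E, \<psi> \<otimes> \<psi>\<rangle> = \<mu>\<close> by the eigenvector equation, and where
  \<open>\<parallel>Q\<parallel>\<^sup>2 \<le> (4/n\<^sup>2) n - 4/n + 1 = 1\<close> because \<open>\<Pi>\<close> has trace at most \<open>n\<close> and fixes \<open>\<psi>\<close>.

  The choice of \<open>Q\<close> comes from the extremal case: it has eigenvalue \<open>2/n - 1\<close> on \<open>\<psi>\<close>
  and \<open>2/n\<close> on the rest of the range of \<open>\<Pi>\<close>, which is the spectrum of \<open>A\<close> if equality holds
  in \<open>trace_bound\<close>.
\<close>

lemma deviation:
  assumes "mass \<noteq> 0"
  obtains p where "\<And>k j. p k j = p j k" "\<And>k j. (\<Sum>l\<in>K. c l * p k l * p l j) = p k j"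
    "\<And>k. k \<in> K \<Longrightarrow> (\<Sum>j\<in>K. c j * p k j * \<psi> j) = \<psi> k"
    "(\<Sum>k\<in>K. \<Sum>j\<in>K. c k * c j * (g k \<bullet> x j - (2 / real DIM('a) * p k j - \<psi> k * \<psi> j))\<^sup>2)
       \<le> 1 + (\<Sum>k\<in>K. \<Sum>j\<in>K. c k * c j * (g k \<bullet> x j)\<^sup>2) - 2 * (2 / real DIM('a) * tr - \<mu>)"
proof -
  obtain p where sym: "\<And>k j. p k j = p j k" and idem: "\<And>k j. (\<Sum>l\<in>K. c l * p k l * p l j) = p k j"
    and rep: "\<And>k h. k \<in> K \<Longrightarrow> (\<Sum>j\<in>K. c j * p k j * (h \<bullet> x j)) = h \<bullet> x k"
    and trp: "(\<Sum>k\<in>K. c k * p k k) \<le> real DIM('a)"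
    using that by (rule kernel)
  let ?n = "real DIM('a)"
  define W where "W h = (\<Sum>k\<in>K. \<Sum>j\<in>K. c k * c j * h k j)" for h :: "'k \<Rightarrow> 'k \<Rightarrow> real"
  let ?E = "\<lambda>k j. g k \<bullet> x j"
  have p\<psi>: "(\<Sum>j\<in>K. c j * p k j * \<psi> j) = \<psi> k" if "k \<in> K" for k
    using rep[OF that, of f] by (simp add: \<psi>_def flip: sum_divide_distrib)
  have Epp: "W (\<lambda>k j. ?E k j * p k j) = tr"
  proof -
    have "W (\<lambda>k j. ?E k j * p k j) = (\<Sum>k\<in>K. c k * (\<Sum>j\<in>K. c j * p k j * (g k \<bullet> x j)))"
      unfolding W_def sum_distrib_left by (simp add: mult_ac)
    then show ?thesis using rep by (simp add: tr_def)
  qed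
  have E\<psi>: "W (\<lambda>k j. ?E k j * (\<psi> k * \<psi> j)) = \<mu>"
  proof -
    have "W (\<lambda>k j. ?E k j * (\<psi> k * \<psi> j)) = (\<Sum>j\<in>K. c j * \<psi> j * (\<Sum>k\<in>K. c k * \<psi> k * (g k \<bullet> x j)))"
      unfolding W_def sum_distrib_left by (subst sum.swap) (simp add: mult_ac)
    also have "\<dots> = \<mu> * (\<Sum>j\<in>K. c j * (\<psi> j)\<^sup>2)"
      unfolding \<psi>_eigen sum_distrib_left by (simp add: power2_eq_square mult_ac)
    finally show ?thesis by (simp add: \<psi>_unit[OF assms])
  qed
  have pp: "W (\<lambda>k j. p k j * p k j) \<le> ?n"
  proof -
    have "W (\<lambda>k j. p k j * p k j) = (\<Sum>k\<in>K. c k * (\<Sum>j\<in>K. c j * p k j * p j k))"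
      unfolding W_def sum_distrib_left by (simp add: mult_ac sym)
    then show ?thesis unfolding idem using trp by simp
  qed
  have p\<psi>\<psi>: "W (\<lambda>k j. p k j * (\<psi> k * \<psi> j)) = 1"
  proof -
    have "W (\<lambda>k j. p k j * (\<psi> k * \<psi> j)) = (\<Sum>k\<in>K. c k * \<psi> k * (\<Sum>j\<in>K. c j * p k j * \<psi> j))"
      unfolding W_def sum_distrib_left by (simp add: mult_ac)
    also have "\<dots> = (\<Sum>k\<in>K. c k * (\<psi> k)\<^sup>2)"
      by (intro sum.cong refl) (simp add: p\<psi> power2_eq_square)
    finally show ?thesis by (simp only: \<psi>_unit[OF assms])
  qed
  have \<psi>4: "W (\<lambda>k j. (\<psi> k * \<psi> j)\<^sup>2) = 1"
  proof -
    have "W (\<lambda>k j. (\<psi> k * \<psi> j)\<^sup>2) = (\<Sum>k\<in>K. c k * (\<psi> k)\<^sup>2) * (\<Sum>j\<in>K. c j * (\<psi> j)\<^sup>2)"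
      unfolding W_def sum_product by (simp add: power_mult_distrib mult_ac)
    then show ?thesis by (simp add: \<psi>_unit[OF assms])
  qed
  have "W (\<lambda>k j. (?E k j - (2 / ?n * p k j - \<psi> k * \<psi> j))\<^sup>2)
      = W (\<lambda>k j. (?E k j)\<^sup>2) + (2 / ?n)\<^sup>2 * W (\<lambda>k j. p k j * p k j) + W (\<lambda>k j. (\<psi> k * \<psi> j)\<^sup>2)
        - 2 * (2 / ?n) * W (\<lambda>k j. ?E k j * p k j) + 2 * W (\<lambda>k j. ?E k j * (\<psi> k * \<psi> j))
        - 2 * (2 / ?n) * W (\<lambda>k j. p k j * (\<psi> k * \<psi> j))"
    unfolding W_def sum_distrib_left sum.distrib[symmetric] sum_subtractf[symmetric]
    by (intro sum.cong refl) (simp only: power2_eq_square, algebra)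
  also have "\<dots> = W (\<lambda>k j. (?E k j)\<^sup>2) + (2 / ?n)\<^sup>2 * W (\<lambda>k j. p k j * p k j) + 1
        - 2 * (2 / ?n * tr - \<mu>) - 4 / ?n"
    unfolding Epp E\<psi> p\<psi>\<psi> \<psi>4 by simp
  also have "(2 / ?n)\<^sup>2 * W (\<lambda>k j. p k j * p k j) \<le> (2 / ?n)\<^sup>2 * ?n"
    using pp by (intro mult_left_mono) auto
  also have "(2 / ?n)\<^sup>2 * ?n = 4 / ?n" by (simp add: power2_eq_square)
  finally show thesis using sym idem p\<psi> unfolding W_def by (intro that[of p]) auto
qed

lemma sum_c_c: "(\<Sum>k\<in>K. \<Sum>j\<in>K. c k * c j) = 1"
  by (simp add: sum_c flip: sum_product)

lemma square_sum_le_1: "(\<Sum>k\<in>K. \<Sum>j\<in>K. c k * c j * (g k \<bullet> x j)\<^sup>2) \<le> 1"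
proof -
  have "(\<Sum>k\<in>K. \<Sum>j\<in>K. c k * c j * (g k \<bullet> x j)\<^sup>2) \<le> (\<Sum>k\<in>K. \<Sum>j\<in>K. c k * c j * 1)"
    using entry_le c_pos
    by (intro sum_mono mult_left_mono) (auto simp: abs_square_le_1 less_imp_le)
  then show ?thesis by (simp add: sum_c_c)
qed

lemma deviation_ge_0: "0 \<le> (\<Sum>k\<in>K. \<Sum>j\<in>K. c k * c j * (h k j)\<^sup>2)"
  using c_pos by (intro sum_nonneg) (auto simp: less_imp_le)

lemma deviation_eq_0:
  assumes "(\<Sum>k\<in>K. \<Sum>j\<in>K. c k * c j * (h k j)\<^sup>2) \<le> 0" "k \<in> K" "j \<in> K"
  shows "h k j = 0"
proof -
  have nn: "0 \<le> c k * c j * (h k j)\<^sup>2" if "k \<in> K" "j \<in> K" for k j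
    using c_pos that by (auto simp: less_imp_le)
  have "(\<Sum>k\<in>K. \<Sum>j\<in>K. c k * c j * (h k j)\<^sup>2) = 0"
    using assms(1) deviation_ge_0[of h] by linarith
  then have "(\<Sum>j\<in>K. c k * c j * (h k j)\<^sup>2) = 0"
    using assms(2) nn by (subst (asm) sum_nonneg_eq_0_iff) (auto simp: finite_K intro: sum_nonneg)
  then have "c k * c j * (h k j)\<^sup>2 = 0"
    using assms(2,3) nn by (subst (asm) sum_nonneg_eq_0_iff) (auto simp: finite_K)
  then show ?thesis using c_pos[OF assms(2)] c_pos[OF assms(3)] by simp
qed

text \<open>
  Nonnegativity of the squared distance gives \<open>(2/n) tr - \<mu> \<le> 1\<close>, and \<open>(1 - 2/n) tr \<le> 1 - 2/n\<close>
  is added to it.  If \<open>f\<close> vanishes at all \<open>x\<^sub>k\<close>, then \<open>\<psi>\<close> cannot be normalised, but then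
  \<open>\<mu> = 0\<close>.
\<close>

proposition trace_bound:
  assumes "2 \<le> DIM('a)" "f \<noteq> 0"
  shows "tr - \<mu> \<le> 2 - 2 / real DIM('a)"
proof (cases "mass = 0")
  case True
  then have "tr - \<mu> \<le> 1" using mass_0_imp[OF True assms(2)] tr_le_1 by simp
  also have "1 \<le> 2 - 2 / real DIM('a)" using assms(1) by (simp add: field_simps)
  finally show ?thesis .
next
  case False
  let ?n = "real DIM('a)"
  obtain p where dev: "(\<Sum>k\<in>K. \<Sum>j\<in>K. c k * c j * (g k \<bullet> x j - (2 / ?n * p k j - \<psi> k * \<psi> j))\<^sup>2)
       \<le> 1 + (\<Sum>k\<in>K. \<Sum>j\<in>K. c k * c j * (g k \<bullet> x j)\<^sup>2) - 2 * (2 / ?n * tr - \<mu>)"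
    using that by (rule deviation[OF False])
  have "2 * (2 / ?n * tr - \<mu>) \<le> 2 * 1"
    using deviation_ge_0[of "\<lambda>k j. g k \<bullet> x j - (2 / ?n * p k j - \<psi> k * \<psi> j)"]
      square_sum_le_1 dev by linarith
  then have "2 / ?n * tr - \<mu> \<le> 1" by simp
  moreover have "(1 - 2 / ?n) * tr \<le> (1 - 2 / ?n) * 1"
    using tr_le_1 assms(1) by (intro mult_left_mono) (auto simp: field_simps)
  ultimately show ?thesis by (simp add: algebra_simps)
qed

text \<open>
  Equality makes every estimate in the bound sharp: \<open>E = Q\<close>, \<open>tr = 1\<close>, \<open>\<mu> = 2/n - 1\<close>, and all
  entries of \<open>E\<close> are \<open>1\<close> or \<open>-1\<close>, with \<open>1\<close> on the diagonal.  The eigenvalues of \<open>Q\<close> give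
  \<open>E\<^sup>2 = (2/n) E + (1 - 2/n) \<psi> \<otimes> \<psi>\<close>.  The diagonal entries of \<open>E\<^sup>2\<close> are \<open>1\<close>, which forces
  \<open>\<psi> k = 1\<close> or \<open>\<psi> k = -1\<close>.  These signs turn \<open>E\<close> into a matrix to which \<open>sign_classes\<close>
  applies.  Dividing by \<open>1 - 2/n\<close> is where dimension \<open>2\<close> is excluded.
\<close>

proposition trace_bound_eq:
  assumes n: "3 \<le> DIM('a)" and f: "f \<noteq> 0" and eq: "2 - 2 / real DIM('a) \<le> tr - \<mu>"
  obtains R \<sigma> where "R \<subseteq> K" "card R = DIM('a)" "\<And>k. k \<in> R \<Longrightarrow> \<bar>\<sigma> k\<bar> = (1::real)"
    "\<And>k j. k \<in> R \<Longrightarrow> j \<in> R \<Longrightarrow>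
      (\<sigma> k *\<^sub>R g k) \<bullet> (\<sigma> j *\<^sub>R x j) = (if k = j then 1 else -1)"
proof -
  let ?n = "real DIM('a)"
  let ?E = "\<lambda>k j. g k \<bullet> x j"
  have n2: "2 / ?n < 1" using n by (simp add: field_simps)
  have m: "mass \<noteq> 0"
  proof
    assume "mass = 0"
    then have "\<mu> = 0" using f by (rule mass_0_imp)
    then show False using tr_le_1 n2 eq by linarith
  qed
  obtain p where sym: "\<And>k j. p k j = p j k" and idem: "\<And>k j. (\<Sum>l\<in>K. c l * p k l * p l j) = p k j"
    and p\<psi>: "\<And>k. k \<in> K \<Longrightarrow> (\<Sum>j\<in>K. c j * p k j * \<psi> j) = \<psi> k"
    and dev: "(\<Sum>k\<in>K. \<Sum>j\<in>K. c k * c j * (?E k j - (2 / ?n * p k j - \<psi> k * \<psi> j))\<^sup>2)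
       \<le> 1 + (\<Sum>k\<in>K. \<Sum>j\<in>K. c k * c j * (?E k j)\<^sup>2) - 2 * (2 / ?n * tr - \<mu>)"
    using that by (rule deviation[OF m])
  have ge: "(1 - 2 / ?n) * (1 - tr) + 1 \<le> 2 / ?n * tr - \<mu>"
  proof -
    have "(1 - 2 / ?n) * (1 - tr) = 1 - tr - 2 / ?n + 2 / ?n * tr" by algebra
    then show ?thesis using eq by linarith
  qed
  note dev0 = deviation_ge_0[of "\<lambda>k j. ?E k j - (2 / ?n * p k j - \<psi> k * \<psi> j)"]
  have "2 * (2 / ?n * tr - \<mu>) \<le> 2 * 1" using dev dev0 square_sum_le_1 by linarith
  then have le1: "2 / ?n * tr - \<mu> \<le> 1" by simp
  have "(1 - 2 / ?n) * (1 - tr) \<le> 0" using order_trans[OF ge le1] by simp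
  then have tr1: "tr = 1" using n2 tr_le_1 by (simp add: mult_le_0_iff)
  have one: "2 / ?n * tr - \<mu> = 1" using ge le1 by (simp add: tr1)
  then have mu: "\<mu> = 2 / ?n - 1" by (simp add: tr1)
  note dev = dev[unfolded one]
  have *: "(\<Sum>k\<in>K. \<Sum>j\<in>K. c k * c j * (?E k j - (2 / ?n * p k j - \<psi> k * \<psi> j))\<^sup>2) \<le> 0"
    using dev square_sum_le_1 by linarith
  have E: "?E k j = 2 / ?n * p k j - \<psi> k * \<psi> j" if "k \<in> K" "j \<in> K" for k j
    using deviation_eq_0[OF * that] by simp
  have sq1: "1 \<le> (\<Sum>k\<in>K. \<Sum>j\<in>K. c k * c j * (?E k j)\<^sup>2)"
    using dev dev0 by linarith
  \<comment> \<open>The nonnegative defect \<open>1 - E\<^sup>2\<close> is written as a square in order to apply \<open>deviation_eq_0\<close>.\<close>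
  have defect: "(\<Sum>k\<in>K. \<Sum>j\<in>K. c k * c j * (sqrt (1 - (?E k j)\<^sup>2))\<^sup>2) \<le> 0"
  proof -
    have "(\<Sum>k\<in>K. \<Sum>j\<in>K. c k * c j * (sqrt (1 - (?E k j)\<^sup>2))\<^sup>2)
        = (\<Sum>k\<in>K. \<Sum>j\<in>K. c k * c j - c k * c j * (?E k j)\<^sup>2)"
      using entry_le by (intro sum.cong refl) (simp add: abs_square_le_1 algebra_simps)
    also have "\<dots> \<le> 0" using sq1 by (simp add: sum_subtractf sum_c_c)
    finally show ?thesis .
  qed
  have Epm: "?E k j = 1 \<or> ?E k j = -1" if "k \<in> K" "j \<in> K" for k j
  proof -
    have "(?E k j)\<^sup>2 = 1" using deviation_eq_0[OF defect that] by simp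
    then show ?thesis by (simp add: power2_eq_1_iff)
  qed
  have Ediag: "?E k k = 1" if "k \<in> K" for k
  proof -
    have "(\<Sum>k\<in>K. c k * (1 - ?E k k)) = 0"
      using tr1 sum_c by (simp add: tr_def right_diff_distrib sum_subtractf)
    moreover have "0 \<le> c k * (1 - ?E k k)" if "k \<in> K" for k
      using Epm[OF that that] c_pos[OF that] by auto
    ultimately have "c k * (1 - ?E k k) = 0"
      using that by (subst (asm) sum_nonneg_eq_0_iff) (auto simp: finite_K)
    then show ?thesis using c_pos[OF that] by simp
  qed
  have Esq: "(\<Sum>j\<in>K. c j * ?E k j * ?E j i) = 2 / ?n * ?E k i + (1 - 2 / ?n) * (\<psi> k * \<psi> i)"
    if "k \<in> K" "i \<in> K" for k i
  proof -
    have "(\<Sum>j\<in>K. c j * ?E k j * ?E j i)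
        = (2 / ?n)\<^sup>2 * (\<Sum>j\<in>K. c j * p k j * p j i) - 2 / ?n * \<psi> i * (\<Sum>j\<in>K. c j * p k j * \<psi> j)
          - 2 / ?n * \<psi> k * (\<Sum>j\<in>K. c j * p i j * \<psi> j) + \<psi> k * \<psi> i * (\<Sum>j\<in>K. c j * (\<psi> j)\<^sup>2)"
      unfolding sum_distrib_left sum.distrib[symmetric] sum_subtractf[symmetric]
    proof (intro sum.cong refl)
      fix j assume "j \<in> K"
      show "c j * ?E k j * ?E j i = (2 / ?n)\<^sup>2 * (c j * p k j * p j i) - 2 / ?n * \<psi> i * (c j * p k j * \<psi> j)
          - 2 / ?n * \<psi> k * (c j * p i j * \<psi> j) + \<psi> k * \<psi> i * (c j * (\<psi> j)\<^sup>2)"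
        unfolding E[OF that(1) \<open>j \<in> K\<close>] E[OF \<open>j \<in> K\<close> that(2)] sym[of i j]
        by (simp only: power2_eq_square, algebra)
    qed
    also have "\<dots> = (2 / ?n)\<^sup>2 * p k i - 2 * (2 / ?n) * (\<psi> k * \<psi> i) + \<psi> k * \<psi> i"
      by (simp add: idem p\<psi> that \<psi>_unit[OF m])
    also have "\<dots> = 2 / ?n * ?E k i + (1 - 2 / ?n) * (\<psi> k * \<psi> i)"
      unfolding E[OF that] by (simp only: power2_eq_square, algebra)
    finally show ?thesis .
  qed
  have Esym: "?E k j = ?E j k" if "k \<in> K" "j \<in> K" for k j
    using E[OF that] E[OF that(2,1)] sym[of k j] by simp
  have psi: "\<psi> k * \<psi> k = 1" if "k \<in> K" for k
  proof -
    have "(\<Sum>j\<in>K. c j * ?E k j * ?E j k) = (\<Sum>j\<in>K. c j)"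
    proof (intro sum.cong refl)
      fix j assume "j \<in> K"
      then show "c j * ?E k j * ?E j k = c j" using Epm[OF that] Esym[OF that] by force
    qed
    then have "2 / ?n * 1 + (1 - 2 / ?n) * (\<psi> k * \<psi> k) = 1"
      unfolding Esq[OF that that] Ediag[OF that] sum_c .
    then have "(1 - 2 / ?n) * (\<psi> k * \<psi> k) = (1 - 2 / ?n) * 1" by algebra
    moreover have "1 - 2 / ?n \<noteq> 0" using n2 by simp
    ultimately show ?thesis using mult_left_cancel by blast
  qed
  have psi1: "\<psi> k = 1 \<or> \<psi> k = -1" if "k \<in> K" for k
    using psi[OF that] by (simp add: square_eq_1_iff)
  define S where "S k j = \<psi> k * \<psi> j * ?E k j" for k j
  have "\<exists>R\<subseteq>K. card R = DIM('a) \<and> (\<forall>k\<in>R. \<forall>j\<in>R. k \<noteq> j \<longrightarrow> S k j = -1)"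
  proof (rule sign_classes[where K = K and c = c and n = "DIM('a)" and S = S])
    show "finite K" "(\<Sum>k\<in>K. c k) = 1" by (fact finite_K sum_c)+
    show "0 < c k" if "k \<in> K" for k using that by (rule c_pos)
    show "0 < DIM('a)" by simp
    show "S k j = 1 \<or> S k j = -1" if "k \<in> K" "j \<in> K" for k j
      using psi1[OF that(1)] psi1[OF that(2)] Epm[OF that] by (auto simp: S_def)
    show "S k k = 1" if "k \<in> K" for k using psi[OF that] Ediag[OF that] by (simp add: S_def)
    show "S k j = S j k" if "k \<in> K" "j \<in> K" for k j using Esym[OF that] by (simp add: S_def)
    show "(\<Sum>j\<in>K. c j * S k j * S j i) = 2 / ?n * S k i + (1 - 2 / ?n)" if "k \<in> K" "i \<in> K" for k i
    proof -
      have "(\<Sum>j\<in>K. c j * S k j * S j i) = \<psi> k * \<psi> i * (\<Sum>j\<in>K. c j * ?E k j * ?E j i)"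
        unfolding sum_distrib_left
      proof (intro sum.cong refl)
        fix j assume "j \<in> K"
        then show "c j * S k j * S j i = \<psi> k * \<psi> i * (c j * ?E k j * ?E j i)"
          using psi1[of j] by (auto simp: S_def)
      qed
      also have "\<dots> = 2 / ?n * S k i + (1 - 2 / ?n) * (\<psi> k * \<psi> k) * (\<psi> i * \<psi> i)"
        unfolding Esq[OF that] S_def by algebra
      finally show ?thesis by (simp add: psi that)
    qed
    show "(\<Sum>j\<in>K. c j * S k j) = 2 / ?n - 1" if "k \<in> K" for k
    proof -
      have "(\<Sum>j\<in>K. c j * S k j) = \<psi> k * (\<Sum>j\<in>K. c j * \<psi> j * ?E j k)"
        unfolding sum_distrib_left using Esym[OF that] by (intro sum.cong refl) (simp add: S_def)
      then show ?thesis using psi[OF that] by (simp add: \<psi>_eigen mu)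
    qed
  qed
  then obtain R where R: "R \<subseteq> K" "card R = DIM('a)"
    and neg: "\<And>k j. k \<in> R \<Longrightarrow> j \<in> R \<Longrightarrow> k \<noteq> j \<Longrightarrow> S k j = -1"
    by blast
  show thesis
  proof (rule that[OF R])
    show "\<bar>\<psi> k\<bar> = 1" if "k \<in> R" for k using psi1[OF subsetD[OF R(1) that]] by auto
    show "(\<psi> k *\<^sub>R g k) \<bullet> (\<psi> j *\<^sub>R x j) = (if k = j then 1 else -1)" if "k \<in> R" "j \<in> R" for k j
    proof (cases "k = j")
      case True
      have "k \<in> K" using that R(1) by blast
      then show ?thesis using True psi[of k] Ediag[of k] by simp
    next
      case False
      then show ?thesis using neg[OF that] by (simp add: S_def mult_ac)
    qed
  qed
qed

end

section \<open>Hyperplanes with maximal projection constant\<close>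

text \<open>
  The map is determined by its facet functionals: if \<open>s\<close> is the sum of the coordinates of \<open>T x\<close>,
  then summing \<open>2 (T x)\<^sub>i - s = h\<^sub>i \<bullet> x\<close> over \<open>i\<close> gives \<open>(2 - n) s = \<Sum>\<^sub>i h\<^sub>i \<bullet> x\<close>.  Reading this
  as the definition of \<open>s\<close> gives \<open>T\<close> without inverting a matrix.
\<close>

lemma sign_coordinates:
  fixes y h :: "'n::finite \<Rightarrow> real ^ 'n"
  assumes n: "3 \<le> CARD('n)"
    and bi: "\<And>i j. h i \<bullet> y j = (if i = j then 1 else -1)"
  obtains T :: "real ^ 'n \<Rightarrow> real ^ 'n" where "linear T" "\<And>j. T (y j) = axis j 1"
    "\<And>i x. 2 * (T x $ i) - (\<Sum>j\<in>UNIV. T x $ j) = h i \<bullet> x"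
proof -
  define s where "s x = - (\<Sum>j\<in>UNIV. h j \<bullet> x) / (real CARD('n) - 2)" for x
  define T :: "real ^ 'n \<Rightarrow> real ^ 'n" where "T x = (\<chi> i. (h i \<bullet> x + s x) / 2)" for x
  have n2: "real CARD('n) - 2 > 0" using n by linarith
  have sT: "(\<Sum>j\<in>UNIV. T x $ j) = s x" for x
  proof -
    have "(\<Sum>j\<in>UNIV. T x $ j) = ((\<Sum>j\<in>UNIV. h j \<bullet> x) + real CARD('n) * s x) / 2"
      by (simp add: T_def sum.distrib flip: sum_divide_distrib)
    also have "(\<Sum>j\<in>UNIV. h j \<bullet> x) = - ((real CARD('n) - 2) * s x)"
      using n2 by (simp add: s_def)
    finally show ?thesis by (simp add: algebra_simps)
  qed
  have s_add: "s (x + z) = s x + s z" for x z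
    by (simp add: s_def inner_add_right sum.distrib add_divide_distrib diff_divide_distrib)
  have s_scale: "s (r *\<^sub>R x) = r * s x" for r x
    by (simp add: s_def flip: sum_distrib_left)
  show thesis
  proof
    show "linear T"
      by (rule linearI)
        (simp_all add: T_def vec_eq_iff inner_add_right s_add s_scale field_simps)
    show "T (y j) = axis j 1" for j
    proof -
      have "(\<Sum>i\<in>UNIV. h i \<bullet> y j) = (\<Sum>i\<in>UNIV. (if i = j then 2 else 0) - 1)"
        by (intro sum.cong refl) (simp add: bi)
      also have "\<dots> = 2 - real CARD('n)" by (simp add: sum_subtractf)
      finally have "s (y j) = 1" using n2 by (simp add: s_def)
      then show ?thesis by (simp add: T_def vec_eq_iff bi axis_def)
    qed
    show "2 * (T x $ i) - (\<Sum>j\<in>UNIV. T x $ j) = h i \<bullet> x" for i x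
      unfolding sT by (simp add: T_def field_simps)
  qed
qed

lemma weighted_pairs_dual:
  fixes N :: "'a::euclidean_space \<Rightarrow> real"
  assumes N: "is_norm N" and f: "f \<noteq> 0"
  obtains K :: "(real \<times> 'a) set" and c x g \<mu> where
    "weighted_pairs K c x g f \<mu>"
    "\<And>k. k \<in> K \<Longrightarrow> x k \<in> unit_ball_wrt N" "\<And>k. k \<in> K \<Longrightarrow> g k \<in> dual_ball N"
    "relative_projection_constant N {y. f \<bullet> y = 0} \<le> weighted_pairs.tr K c x g - \<mu>"
proof -
  obtain K :: "(real \<times> 'a) set" and c x g \<mu> where
    *: "finite K" "\<And>k. k \<in> K \<Longrightarrow> 0 < c k" "(\<Sum>k\<in>K. c k) = (1::real)"
    "\<And>k. k \<in> K \<Longrightarrow> x k \<in> unit_ball_wrt N" "\<And>k. k \<in> K \<Longrightarrow> g k \<in> dual_ball N"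
    "(\<Sum>k\<in>K. (c k * (f \<bullet> x k)) *\<^sub>R g k) = \<mu> *\<^sub>R f"
    "relative_projection_constant N {y. f \<bullet> y = 0} \<le> (\<Sum>k\<in>K. c k * (g k \<bullet> x k)) - \<mu>"
    using that by (rule projection_constant_dual[OF N f])
  have "\<bar>g k \<bullet> x j\<bar> \<le> 1" if "k \<in> K" "j \<in> K" for k j
    using dual_ball_abs_le[OF N *(5)[OF that(1)], of "x j"] *(4)[OF that(2)]
    by (simp add: unit_ball_wrt_def)
  then have wp: "weighted_pairs K c x g f \<mu>" using * by unfold_locales auto
  show thesis
    using *(7) by (intro that[OF wp *(4,5)]) (auto simp: weighted_pairs.tr_def[OF wp])
qed

text \<open>
  This is Bohnenblust's inequality.
\<close>

proposition relative_projection_constant_hyperplane_le: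
  fixes N :: "'a::euclidean_space \<Rightarrow> real"
  assumes N: "is_norm N" and f: "f \<noteq> 0" and n: "2 \<le> DIM('a)"
  shows "relative_projection_constant N {y. f \<bullet> y = 0} \<le> 2 - 2 / real DIM('a)"
proof (rule weighted_pairs_dual[OF N f])
  fix K :: "(real \<times> 'a) set" and c x g \<mu>
  assume wp: "weighted_pairs K c x g f \<mu>"
    and le: "relative_projection_constant N {y. f \<bullet> y = 0} \<le> weighted_pairs.tr K c x g - \<mu>"
  show ?thesis using le weighted_pairs.trace_bound[OF wp n f] by linarith
qed

text \<open>
  The cross-polytope is covered since \<open>T\<close> sends points \<open>y i\<close> of the unit ball to its vertices; the
  parallelotope contains the image since its facet functionals pull back to elements of the dual
  ball.
\<close>

lemma maximal_hyperplane_imp_sandwich: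
  fixes N :: "real ^ 'n \<Rightarrow> real"
  assumes n: "3 \<le> CARD('n)" and N: "is_norm N" and f: "f \<noteq> 0"
    and max: "2 - 2 / real CARD('n) \<le> relative_projection_constant N {y. f \<bullet> y = 0}"
  obtains T :: "real ^ 'n \<Rightarrow> real ^ 'n" where "linear T"
    "cross_polytope \<subseteq> T ` unit_ball_wrt N" "T ` unit_ball_wrt N \<subseteq> sign_parallelotope"
proof (rule weighted_pairs_dual[OF N f])
  fix K :: "(real \<times> (real ^ 'n)) set" and c x g \<mu>
  assume wp: "weighted_pairs K c x g f \<mu>"
    and x: "\<And>k. k \<in> K \<Longrightarrow> x k \<in> unit_ball_wrt N" and g: "\<And>k. k \<in> K \<Longrightarrow> g k \<in> dual_ball N"
    and le: "relative_projection_constant N {y. f \<bullet> y = 0} \<le> weighted_pairs.tr K c x g - \<mu>"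
  have dim: "3 \<le> DIM(real ^ 'n)" using n by simp
  have ge: "2 - 2 / real DIM(real ^ 'n) \<le> weighted_pairs.tr K c x g - \<mu>" using le max by simp
  obtain R \<sigma> where R: "R \<subseteq> K" "card R = DIM(real ^ 'n)" and \<sigma>: "\<And>k. k \<in> R \<Longrightarrow> \<bar>\<sigma> k\<bar> = (1::real)"
    and bi: "\<And>k j. k \<in> R \<Longrightarrow> j \<in> R \<Longrightarrow> (\<sigma> k *\<^sub>R g k) \<bullet> (\<sigma> j *\<^sub>R x j) = (if k = j then 1 else -1)"
    using that by (rule weighted_pairs.trace_bound_eq[OF wp dim f ge])
  have "finite R" using R(2) by (intro card_ge_0_finite) simp
  then obtain e where e: "bij_betw e (UNIV :: 'n set) R"
    using finite_same_card_bij[of "UNIV :: 'n set" R] R(2) by auto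
  have eR: "e i \<in> R" for i using e by (auto simp: bij_betw_def)
  define y where "y i = \<sigma> (e i) *\<^sub>R x (e i)" for i
  define h where "h i = \<sigma> (e i) *\<^sub>R g (e i)" for i
  have y: "N (y i) \<le> 1" for i
    using x[of "e i"] \<sigma>[OF eR] eR[of i] R(1) by (auto simp: y_def is_norm_scale[OF N] unit_ball_wrt_def)
  have h: "h i \<in> dual_ball N" for i
  proof -
    have "\<sigma> (e i) = 1 \<or> \<sigma> (e i) = -1" using \<sigma>[OF eR, of i] by linarith
    then show ?thesis
      using g[of "e i"] eR[of i] R(1) dual_ball_minus[OF N, of "g (e i)"] by (auto simp: h_def)
  qed
  have hy: "h i \<bullet> y j = (if i = j then 1 else -1)" for i j
    unfolding h_def y_def bi[OF eR eR] using e by (auto simp: bij_betw_def inj_def)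
  obtain T :: "real ^ 'n \<Rightarrow> real ^ 'n" where T: "linear T" "\<And>j. T (y j) = axis j 1"
    "\<And>i x. 2 * (T x $ i) - (\<Sum>j\<in>UNIV. T x $ j) = h i \<bullet> x"
    using that by (rule sign_coordinates[OF n hy])
  show thesis
  proof
    show "linear T" by fact
    show "cross_polytope \<subseteq> T ` unit_ball_wrt N"
    proof
      fix z :: "real ^ 'n" assume z: "z \<in> cross_polytope"
      let ?v = "\<Sum>i\<in>UNIV. (z $ i) *\<^sub>R y i"
      have "N ?v \<le> (\<Sum>i\<in>UNIV. N ((z $ i) *\<^sub>R y i))" by (rule is_norm_sum[OF N]) simp
      also have "\<dots> \<le> (\<Sum>i\<in>UNIV. \<bar>z $ i\<bar>)"
        using y by (intro sum_mono) (simp add: is_norm_scale[OF N] mult_left_le)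
      finally have "?v \<in> unit_ball_wrt N" using z by (simp add: unit_ball_wrt_def cross_polytope_def)
      moreover have "T ?v = z"
        by (simp add: linear_sum[OF T(1)] linear_scale[OF T(1)] T(2) vec_eq_iff axis_def if_distrib cong: if_cong)
      ultimately show "z \<in> T ` unit_ball_wrt N" by force
    qed
    show "T ` unit_ball_wrt N \<subseteq> sign_parallelotope"
    proof (clarsimp simp: sign_parallelotope_def unit_ball_wrt_def)
      fix v i assume "N v \<le> 1"
      then have "\<bar>h i \<bullet> v\<bar> \<le> 1" using dual_ball_abs_le[OF N h, of i v] by linarith
      moreover have "(\<Sum>j\<in>UNIV - {i}. T v $ j) = (\<Sum>j\<in>UNIV. T v $ j) - T v $ i"
        by (simp add: sum_diff1)
      ultimately show "\<bar>(\<Sum>j\<in>UNIV - {i}. T v $ j) - T v $ i\<bar> \<le> 1"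
        using T(3)[of v i] by (simp add: abs_minus_commute)
    qed
  qed
qed

text \<open>
  Let \<open>T (y i) = e\<^sub>i\<close>.  The differences \<open>y i - y j\<close> lie in the hyperplane, so \<open>y i - P (y i)\<close> is a
  vector \<open>w\<close> that does not depend on \<open>i\<close>, and the coordinates of \<open>T w\<close> sum to \<open>1\<close>.  The \<open>i\<close>-th
  facet functional has the value \<open>2 (1 - (T w)\<^sub>i)\<close> at \<open>P (y i)\<close>.  These \<open>n\<close> values sum to
  \<open>2 (n - 1)\<close>, and none of them exceeds the norm of \<open>P\<close>.
\<close>

lemma sandwich_imp_projection_large:
  fixes N :: "real ^ 'n \<Rightarrow> real" and T :: "real ^ 'n \<Rightarrow> real ^ 'n"
  assumes N: "is_norm N" and T: "linear T"
    and sub: "cross_polytope \<subseteq> T ` unit_ball_wrt N"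
    and sup: "T ` unit_ball_wrt N \<subseteq> sign_parallelotope"
    and P: "P \<in> projections_onto N {x. (\<Sum>i\<in>UNIV. T x $ i) = 0}"
  shows "2 - 2 / real CARD('n) \<le> onorm_wrt N P"
proof -
  let ?n = "real CARD('n)"
  define s where "s x = (\<Sum>i\<in>UNIV. T x $ i)" for x
  have s_diff: "s (a - b) = s a - s b" for a b
    by (simp add: s_def linear_diff[OF T] sum_subtractf)
  have P: "P \<in> projections_onto N {x. s x = 0}" using P by (simp add: s_def)
  then have linP: "linear P" and s0: "\<And>x. s (P x) = 0" and fixP: "\<And>x. s x = 0 \<Longrightarrow> P x = x"
    by (auto simp: projections_onto_def bounded_linear_wrt_def)
  have "\<exists>x. T x = axis i 1 \<and> N x \<le> 1" for i
  proof -
    have "axis i 1 \<in> cross_polytope"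
      by (simp add: cross_polytope_def axis_def if_distrib cong: if_cong)
    then show ?thesis using sub unfolding unit_ball_wrt_def by (metis (mono_tags) imageE mem_Collect_eq subsetD)
  qed
  then obtain y where Ty: "\<And>i. T (y i) = axis i 1" and Ny: "\<And>i. N (y i) \<le> 1" by metis
  have sy: "s (y i) = 1" for i by (simp add: s_def Ty axis_def)
  have coord: "\<bar>2 * (T x $ i) - s x\<bar> \<le> N x" for x i
  proof (cases "x = 0")
    case True
    then show ?thesis by (simp add: s_def linear_0[OF T] N)
  next
    case False
    then have p: "0 < N x" by (rule is_norm_pos[OF N])
    have "x /\<^sub>R N x \<in> unit_ball_wrt N" using p by (simp add: unit_ball_wrt_def is_norm_scale[OF N])
    then have "T (x /\<^sub>R N x) \<in> sign_parallelotope" using sup by blast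
    then have "\<bar>(\<Sum>j\<in>UNIV - {i}. T (x /\<^sub>R N x) $ j) - T (x /\<^sub>R N x) $ i\<bar> \<le> 1"
      by (simp add: sign_parallelotope_def)
    moreover have "(\<Sum>j\<in>UNIV - {i}. z $ j) - z $ i = (\<Sum>j\<in>UNIV. z $ j) - 2 * (z $ i)" for z :: "real ^ 'n"
      by (simp add: sum_diff1)
    ultimately have "\<bar>(\<Sum>j\<in>UNIV. T (x /\<^sub>R N x) $ j) - 2 * (T (x /\<^sub>R N x) $ i)\<bar> \<le> 1"
      by (simp only:)
    moreover have "(\<Sum>j\<in>UNIV. T (x /\<^sub>R N x) $ j) - 2 * (T (x /\<^sub>R N x) $ i) = (s x - 2 * (T x $ i)) / N x"
      by (simp add: linear_scale[OF T] s_def divide_inverse algebra_simps flip: sum_distrib_left)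
    ultimately show ?thesis using p by (simp add: abs_minus_commute)
  qed
  obtain i0 :: 'n where True by blast
  define w where "w = y i0 - P (y i0)"
  have Py: "P (y i) = y i - w" for i
    using fixP[of "y i - y i0"] by (simp add: s_diff sy linear_diff[OF linP] w_def algebra_simps)
  have sw: "s w = 1" by (simp add: w_def s_diff sy s0)
  have bnd: "2 * (1 - T w $ i) \<le> onorm_wrt N P" for i
  proof -
    have "2 * (1 - T w $ i) = 2 * (T (P (y i)) $ i) - s (P (y i))"
      unfolding s0 by (simp add: Py linear_diff[OF T] Ty)
    also have "\<dots> \<le> N (P (y i))" using coord[where x = "P (y i)" and i = i] by linarith
    also have "\<dots> \<le> onorm_wrt N P * N (y i)" by (rule onorm_wrt_upper[OF N P])
    also have "\<dots> \<le> onorm_wrt N P * 1" by (intro mult_left_mono Ny onorm_wrt_ge_0[OF N P])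
    finally show ?thesis by simp
  qed
  have "2 * (?n - 1) = (\<Sum>i\<in>UNIV. 2 * (1 - T w $ i))"
    using sw by (simp add: s_def sum_subtractf flip: sum_distrib_left)
  also have "\<dots> \<le> ?n * onorm_wrt N P"
    using sum_mono[of UNIV "\<lambda>i. 2 * (1 - T w $ i)" "\<lambda>_. onorm_wrt N P"] bnd by simp
  finally show ?thesis by (simp add: field_simps)
qed

theorem corollary2p5:
  fixes N :: "real ^ 'n \<Rightarrow> real"
  assumes "CARD('n) \<ge> 3"
    and "is_norm N"
  shows "(\<exists>Y :: (real ^ 'n) set. subspace Y \<and> dim Y = CARD('n) - 1 \<and>
            relative_projection_constant N Y = 2 - 2 / real CARD('n))
     \<longleftrightarrow>
         (\<exists>T :: real ^ 'n \<Rightarrow> real ^ 'n. linear T \<and>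
            cross_polytope \<subseteq> T ` unit_ball_wrt N \<and>
            T ` unit_ball_wrt N \<subseteq> sign_parallelotope)"
proof
  assume "\<exists>Y :: (real ^ 'n) set. subspace Y \<and> dim Y = CARD('n) - 1 \<and>
            relative_projection_constant N Y = 2 - 2 / real CARD('n)"
  then obtain Y :: "(real ^ 'n) set" where Y: "subspace Y" "dim Y = CARD('n) - 1"
    and max: "relative_projection_constant N Y = 2 - 2 / real CARD('n)" by blast
  obtain f where f: "f \<noteq> 0" "Y = {y. f \<bullet> y = 0}"
    using Y dim_eq_hyperplane[of Y] by (auto simp: span_eq_iff[THEN iffD2])
  show "\<exists>T :: real ^ 'n \<Rightarrow> real ^ 'n. linear T \<and> cross_polytope \<subseteq> T ` unit_ball_wrt N \<and>
            T ` unit_ball_wrt N \<subseteq> sign_parallelotope"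
    using maximal_hyperplane_imp_sandwich[OF assms f(1)] max f(2) by (metis order_refl)
next
  assume "\<exists>T :: real ^ 'n \<Rightarrow> real ^ 'n. linear T \<and> cross_polytope \<subseteq> T ` unit_ball_wrt N \<and>
            T ` unit_ball_wrt N \<subseteq> sign_parallelotope"
  then obtain T :: "real ^ 'n \<Rightarrow> real ^ 'n" where T: "linear T"
    and sub: "cross_polytope \<subseteq> T ` unit_ball_wrt N"
    and sup: "T ` unit_ball_wrt N \<subseteq> sign_parallelotope" by blast
  \<comment> \<open>The vector \<open>1\<close> has all coordinates \<open>1\<close>, so this \<open>f\<close> represents the coordinate sum of \<open>T x\<close>.\<close>
  define f where "f = adjoint T 1"
  have fx: "f \<bullet> x = (\<Sum>i\<in>UNIV. T x $ i)" for x
    unfolding f_def adjoint_clauses(2)[OF T] by (simp add: inner_vec_def)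
  have f0: "f \<noteq> 0"
  proof
    assume f: "f = 0"
    obtain i :: 'n where True by blast
    have "axis i 1 \<in> (cross_polytope :: (real ^ 'n) set)"
      by (simp add: cross_polytope_def axis_def if_distrib cong: if_cong)
    then obtain x where "T x = axis i 1" using sub by force
    then show False using fx[of x] f by (simp add: axis_def)
  qed
  let ?Y = "{y. f \<bullet> y = 0}"
  have "2 - 2 / real CARD('n) \<le> relative_projection_constant N ?Y"
    unfolding relative_projection_constant_def
    by (intro cINF_greatest projections_onto_hyperplane_nonempty assms(2) f0
        sandwich_imp_projection_large[OF assms(2) T sub sup]) (simp add: fx)
  moreover have "relative_projection_constant N ?Y \<le> 2 - 2 / real CARD('n)"
    using relative_projection_constant_hyperplane_le[OF assms(2) f0] assms(1) by simp
  moreover have "subspace ?Y" by (rule subspace_hyperplane)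
  moreover have "dim ?Y = CARD('n) - 1" using dim_hyperplane[OF f0] by simp
  ultimately show "\<exists>Y :: (real ^ 'n) set. subspace Y \<and> dim Y = CARD('n) - 1 \<and>
            relative_projection_constant N Y = 2 - 2 / real CARD('n)"
    by (intro exI[of _ ?Y]) auto
qed

end
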